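(* We have $$\sum_{k=0}^\infty \frac{\binom{2k}{k}^5} {(-2^{20})^k} \left( (820k^2+180k+13) (49 H_{2k}^{(4)} - 3H_k^{(4)}) - \frac{195}{(2k+1)^2} \right) = -\frac{896}{45} \pi^2.$$
   Context: For integers $m\ge1$ and $n\ge0$, $H_n^{(m)}=\sum_{0<j\le n}\frac1{j^m}$ denotes the harmonic number of order $m$ (so $H_0^{(m)}=0$). *)

theory Defs
  imports "HOL-Analysis.Analysis"
begin

definition harmonic_number :: "nat \<Rightarrow> nat \<Rightarrow> real" where
  "harmonic_number m n = (\<Sum>j\<in>{0<..n}. 1 / real j ^ m)"

end

theory Submission
  imports Defs "HOL-Real_Asymp.Real_Asymp"
begin

text \<open>
  The identity is the first-order part, in a parameter \<open>t\<close>, of a one-parameter deformation of Guillera's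
  series \<open>\<Sum>k. (2k choose k)^5 / (-2^20)^k * (820 k^2 + 180 k + 13) = 128 / pi^2\<close>. Write
  \<open>(a)_n = a (a+1) \<cdots> (a+n-1)\<close> and put
  \[ W_t(n,j) = (-1)^n \frac{(1/2)_n}{4^n n!}
      \frac{\prod_{m<n} ((m+1/2)^4 + 4t) \prod_{m<j} ((m+1/2)^4 - t)}{\prod_{1 \le m \le n+j} (m^4 - t)}. \]
  Then \<open>F_t(n,j) = n (2j + n + 1/2) W_t(n,j)\<close> and \<open>G_t(n,j) = c(n,j) W_t(n,j)\<close>, with a quadratic
  polynomial \<open>c\<close> free of \<open>t\<close>, form a Wilf-Zeilberger pair:
  \<open>F_t(n+1,j) - F_t(n,j) = G_t(n,j+1) - G_t(n,j)\<close>. Differentiating at \<open>t = 0\<close> multiplies \<open>W_0\<close> by its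
  logarithmic derivative, a combination of harmonic numbers of order 4, and the derivatives again form
  such a pair (lemma \<open>wz_pair\<close>). Below, \<open>F\<close> and \<open>G\<close> without index are these derivatives.

  A Wilf-Zeilberger pair is a closed 1-form on the grid: a step in direction \<open>j\<close> carries \<open>F(n,j)\<close>, a
  step in direction \<open>n\<close> carries \<open>G(n,j)\<close>, and sums along lattice paths depend only on the end points.
  Along the staircase from \<open>(0,0)\<close> to \<open>(M,M)\<close> one collects the summands of the theorem, up to the
  factor 256 (lemma \<open>diagonal_step\<close>). Going first along \<open>n = 0\<close>, where \<open>F\<close> vanishes, and then along
  \<open>j = M\<close> one collects \<open>G(0,M) + \<dots> + G(M-1,M)\<close>. As \<open>M\<close> grows only \<open>G(0,M)\<close> survives: by Wallis'
  product \<open>c(0,M) W_0(0,M)\<close> tends to \<open>1 / (2 pi^2)\<close>, and the logarithmic derivative tends to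
  \<open>zeta(4) - 15 zeta(4)\<close>. The value of the series is therefore \<open>256 * (-14 zeta(4)) / (2 pi^2)\<close>, and
  \<open>zeta(4) = pi^4 / 90\<close>.
\<close>

section \<open>Fourth-order harmonic numbers and their limit\<close>

abbreviation H4 :: "nat \<Rightarrow> real" where
  "H4 \<equiv> harmonic_number 4"

lemma H4_Suc: "H4 (Suc n) = H4 n + 1 / (real n + 1) ^ 4"
proof -
  have "{0<..Suc n} = insert (Suc n) {0<..n}" by auto
  then show ?thesis by (simp add: harmonic_number_def add.commute)
qed

lemma H4_0: "H4 0 = 0"
  by (simp add: harmonic_number_def)

definition zeta4 :: real where
  "zeta4 = (\<Sum>n. 1 / real (Suc n) ^ 4)"

lemma H4_eq_sum: "H4 n = (\<Sum>k<n. 1 / real (Suc k) ^ 4)"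
  by (induction n) (simp_all add: H4_0 H4_Suc add.commute)

lemma summable_fourth_powers: "summable (\<lambda>n. 1 / real (Suc n) ^ 4)"
proof -
  have "summable (\<lambda>n. inverse (real n ^ 4))"
    by (rule inverse_power_summable) simp
  then show ?thesis
    using summable_Suc_iff[of "\<lambda>n. inverse (real n ^ 4)"] by (simp only: inverse_eq_divide)
qed

lemma H4_tendsto: "H4 \<longlonglongrightarrow> zeta4"
  using summable_LIMSEQ[OF summable_fourth_powers]
  by (simp add: H4_eq_sum[abs_def] zeta4_def)

lemma H4_bounds: "0 \<le> H4 n" "H4 n \<le> zeta4"
proof -
  show "0 \<le> H4 n"
    unfolding H4_eq_sum by (rule sum_nonneg) simp
  show "H4 n \<le> zeta4"
    unfolding H4_eq_sum zeta4_def by (rule sum_le_suminf[OF summable_fourth_powers]) simp_all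
qed

text \<open>
  The factor \<open>1 - x^4/k^4\<close> splits as \<open>(1 - x^2/k^2) (1 + x^2/k^2)\<close>, and the second factor is the first one
  at \<open>\<i> x\<close>; so this is Euler's sine product at \<open>x\<close> times the one at \<open>\<i> x\<close>.
\<close>
lemma sin_sinh_product:
  fixes x :: real
  assumes "x > 0"
  shows "(\<lambda>n. \<Prod>k=1..n. 1 - x ^ 4 / real k ^ 4)
           \<longlonglongrightarrow> sin (pi * x) * sinh (pi * x) / (pi * x) ^ 2"
proof -
  let ?z = "\<i> * of_real x :: complex"
  let ?c = "of_real pi * ?z"
  have c0: "?c \<noteq> 0" using assms by simp
  have "(\<lambda>n. (of_real pi * ?z * (\<Prod>k=1..n. 1 - ?z^2 / of_nat k^2)) / ?c)
          \<longlonglongrightarrow> sin (of_real pi * ?z) / ?c"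
    by (intro tendsto_divide sin_product_formula_complex tendsto_const c0)
  also have "(\<lambda>n. (of_real pi * ?z * (\<Prod>k=1..n. 1 - ?z^2 / of_nat k^2)) / ?c)
           = (\<lambda>n. of_real (\<Prod>k=1..n. 1 + x^2 / real k^2))"
    using c0 by (simp add: power_mult_distrib)
  also have "sin (of_real pi * ?z) / ?c = of_real (sinh (pi * x) / (pi * x))"
  proof -
    have "sin (of_real pi * ?z) = \<i> * of_real (sinh (pi * x))"
      by (simp add: sin_i_times mult.left_commute sinh_field_def exp_minus exp_of_real flip: of_real_mult)
    then show ?thesis using assms by simp
  qed
  finally have *: "(\<lambda>n. \<Prod>k=1..n. 1 + x^2 / real k^2) \<longlonglongrightarrow> sinh (pi * x) / (pi * x)"
    by (subst (asm) tendsto_of_real_iff)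
  have "(\<lambda>n. (\<Prod>k=1..n. 1 - x^2 / real k^2) * (\<Prod>k=1..n. 1 + x^2 / real k^2))
     \<longlonglongrightarrow> (sin (pi * x) / (pi * x)) * (sinh (pi * x) / (pi * x))"
    using assms by (intro tendsto_mult * sin_product_formula_real') auto
  also have "(\<lambda>n. (\<Prod>k=1..n. 1 - x^2 / real k^2) * (\<Prod>k=1..n. 1 + x^2 / real k^2))
     = (\<lambda>n. \<Prod>k=1..n. 1 - x^4 / real k^4)"
    by (simp add: prod.distrib[symmetric] algebra_simps power_mult_distrib flip: power_add)
  finally show ?thesis by (simp add: power2_eq_square)
qed

text \<open>
  The value is read off from the coefficient of \<open>x^4\<close> in the product
  \<open>\<Prod>k. 1 - x^4/k^4\<close>. Instead of expanding the product, it is squeezed between \<open>1 - x^4 zeta4\<close>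
  and \<open>exp (- x^4 zeta4)\<close>, two functions with the same coefficient; comparing with the expansion
  \<open>1 - y^4/90 + \<dots>\<close> of \<open>sin y sinh y / y^2\<close>, where \<open>y = pi x\<close>, gives the value.
\<close>
lemma zeta4_eq: "zeta4 = pi ^ 4 / 90"
proof -
  let ?q = "\<lambda>x::real. sin (pi * x) * sinh (pi * x) / (pi * x) ^ 2"
  have bounds: "1 - x ^ 4 * zeta4 \<le> ?q x \<and> ?q x \<le> exp (- (x ^ 4 * zeta4))"
    if x: "0 < x" "x < 1" for x :: real
  proof
    have H: "(\<Sum>k=1..n. x ^ 4 / real k ^ 4) = x ^ 4 * H4 n" for n
    proof -
      have "{0<..n} = {1..n}" by auto
      then show ?thesis by (simp add: harmonic_number_def sum_distrib_left)
    qed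
    have le1: "x ^ 4 / real k ^ 4 \<in> {0..1}" if "k \<in> {1..n}" for k n
    proof -
      have "x ^ 4 \<le> 1 ^ 4" using x by (intro power_mono) auto
      also have "1 ^ 4 \<le> real k ^ 4" using that by (intro power_mono) auto
      finally show ?thesis using that by (simp add: field_simps)
    qed
    note lim = sin_sinh_product[OF x(1)]
    have "1 - x ^ 4 * H4 n \<le> (\<Prod>k=1..n. 1 - x ^ 4 / real k ^ 4)" for n
      unfolding H[symmetric] by (rule Weierstrass_prod_ineq) (rule le1)
    moreover have "(\<lambda>n. 1 - x ^ 4 * H4 n) \<longlonglongrightarrow> 1 - x ^ 4 * zeta4"
      by (intro tendsto_intros H4_tendsto)
    ultimately show "1 - x ^ 4 * zeta4 \<le> ?q x"
      using lim by (intro LIMSEQ_le) auto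
    have "(\<Prod>k=1..n. 1 - x ^ 4 / real k ^ 4) \<le> exp (- (x ^ 4 * H4 n))" for n
    proof -
      have "(\<Prod>k=1..n. 1 - x ^ 4 / real k ^ 4) \<le> (\<Prod>k=1..n. exp (- (x ^ 4 / real k ^ 4)))"
      proof (rule prod_mono)
        fix k assume "k \<in> {1..n}"
        then show "0 \<le> 1 - x ^ 4 / real k ^ 4 \<and> 1 - x ^ 4 / real k ^ 4 \<le> exp (- (x ^ 4 / real k ^ 4))"
          using le1[of k n] exp_ge_add_one_self[of "- (x ^ 4 / real k ^ 4)"] by simp
      qed
      also have "\<dots> = exp (- (x ^ 4 * H4 n))"
        by (simp add: exp_sum[symmetric] H[symmetric] sum_negf)
      finally show ?thesis .
    qed
    moreover have "(\<lambda>n. exp (- (x ^ 4 * H4 n))) \<longlonglongrightarrow> exp (- (x ^ 4 * zeta4))"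
      by (intro tendsto_intros H4_tendsto)
    ultimately show "?q x \<le> exp (- (x ^ 4 * zeta4))"
      using lim by (intro LIMSEQ_le) auto
  qed
  let ?q' = "\<lambda>y::real. sin y * sinh y / y ^ 2" and ?c = "zeta4 / pi ^ 4"
  \<comment> \<open>In the variable \<open>y = pi x\<close> the expansion at 0 has rational coefficients.\<close>
  have bounds': "\<forall>\<^sub>F y in at_right 0. 0 < y \<and> 1 - y ^ 4 * ?c \<le> ?q' y \<and> ?q' y \<le> exp (- (y ^ 4 * ?c))"
  proof (rule eventually_at_rightI[of 0 1])
    fix y :: real assume "y \<in> {0<..<1}"
    then have "0 < y / pi" "y / pi < 1" "0 < y" using pi_gt3 by auto
    then show "0 < y \<and> 1 - y ^ 4 * ?c \<le> ?q' y \<and> ?q' y \<le> exp (- (y ^ 4 * ?c))"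
      using bounds[of "y / pi"] by (simp add: power_divide)
  qed simp
  have lim: "((\<lambda>y. (1 - ?q' y) / y ^ 4) \<longlongrightarrow> 1 / 90) (at_right 0)"
    unfolding sinh_field_def by real_asymp
  have "1 / 90 \<le> ?c"
  proof (rule tendsto_upperbound[OF lim])
    show "\<forall>\<^sub>F y in at_right 0. (1 - ?q' y) / y ^ 4 \<le> ?c"
      using bounds'
    proof eventually_elim
      case (elim y)
      then have "1 - ?q' y \<le> ?c * y ^ 4" by (simp add: mult.commute)
      with elim show ?case by (simp add: pos_divide_le_eq)
    qed
  qed simp
  moreover have "?c \<le> 1 / 90"
  proof (rule tendsto_le[OF _ lim])
    have "((\<lambda>y. (1 - exp (- (y ^ 4 * c))) / y ^ 4) \<longlongrightarrow> c) (at_right 0)" for c :: real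
      by real_asymp
    then show "((\<lambda>y. (1 - exp (- (y ^ 4 * ?c))) / y ^ 4) \<longlongrightarrow> ?c) (at_right 0)" .
    show "\<forall>\<^sub>F y in at_right 0. (1 - exp (- (y ^ 4 * ?c))) / y ^ 4 \<le> (1 - ?q' y) / y ^ 4"
      using bounds'
    proof eventually_elim
      case (elim y)
      then show ?case by (intro divide_right_mono) auto
    qed
  qed simp
  ultimately have "?c = 1 / 90" by simp
  then show ?thesis by (simp add: field_simps)
qed

section \<open>Central binomial coefficients\<close>

text \<open>The ratio of Pochhammer symbols \<open>(1/2)_n / (1)_n\<close>.\<close>
definition central_ratio :: "nat \<Rightarrow> real" where
  "central_ratio n = real ((2 * n) choose n) / 4 ^ n"

lemma central_ratio_Suc:
  "central_ratio (Suc n) = central_ratio n * (2 * real n + 1) / (2 * real n + 2)"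
proof -
  have "real (Suc n) * real ((2 * Suc n) choose Suc n) = 2 * (2 * real n + 1) * real ((2 * n) choose n)"
  proof -
    have "Suc n * ((2 * Suc n) choose Suc n) = 2 * Suc (2 * n) * ((2 * n) choose n)"
    proof -
      have a: "Suc n * (Suc (Suc (2 * n)) choose Suc n) = Suc (Suc (2 * n)) * (Suc (2 * n) choose n)"
        by (rule Suc_times_binomial)
      have b: "Suc n * (Suc (2 * n) choose n) = Suc (2 * n) * ((2 * n) choose n)"
        using binomial_absorb_comp[of "Suc (2 * n)" n] by simp
      show ?thesis using a b by (simp add: algebra_simps)
    qed
    from arg_cong[OF this, of real] show ?thesis by (simp add: algebra_simps)
  qed
  then show ?thesis unfolding central_ratio_def by (simp add: divide_simps) (simp add: algebra_simps)
qed

lemma central_ratio_pos: "central_ratio n > 0"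
  by (simp add: central_ratio_def)

lemma central_ratio_le_1: "central_ratio n \<le> 1"
proof (induction n)
  case (Suc n)
  have "central_ratio n * (2 * real n + 1) \<le> 1 * (2 * real n + 2)"
    using Suc central_ratio_pos[of n] by (intro mult_mono) auto
  then show ?case by (simp add: central_ratio_Suc divide_le_eq)
qed (simp add: central_ratio_def)

text \<open>The partial products of Wallis' formula are \<open>1 / (central_ratio n^2 * (2n + 1))\<close>.\<close>
lemma central_ratio_asymp: "(\<lambda>n. real n * central_ratio n ^ 2) \<longlonglongrightarrow> 1 / pi"
proof -
  have P: "(\<Prod>k=1..n. (4*real k^2) / (4*real k^2 - 1)) = 1 / (central_ratio n ^ 2 * (2 * real n + 1))" for n
  proof (induction n)
    case (Suc n)
    let ?c = "central_ratio n"
    have "(\<Prod>k=1..Suc n. (4*real k^2) / (4*real k^2 - 1))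
        = 1 / (?c ^ 2 * (2 * real n + 1)) * ((4 * real (Suc n) ^ 2) / (4 * real (Suc n) ^ 2 - 1))"
      using Suc by simp
    also have "4 * real (Suc n) ^ 2 - 1 = (2 * real n + 1) * (2 * real n + 3)"
      by (simp add: power2_eq_square algebra_simps)
    also have "1 / (?c ^ 2 * (2 * real n + 1)) * ((4 * real (Suc n) ^ 2) / ((2 * real n + 1) * (2 * real n + 3)))
        = 1 / (central_ratio (Suc n) ^ 2 * (2 * real (Suc n) + 1))"
      using central_ratio_pos[of n]
      by (simp add: central_ratio_Suc divide_simps) (simp add: power2_eq_square algebra_simps)
    finally show ?case .
  qed (simp add: central_ratio_def)
  have "(\<lambda>n. inverse (\<Prod>k=1..n. (4*real k^2) / (4*real k^2 - 1)) * (real n / (2 * real n + 1)))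
          \<longlonglongrightarrow> inverse (pi / 2) * (1 / 2)"
  proof (intro tendsto_mult tendsto_inverse wallis)
    show "(\<lambda>n. real n / (2 * real n + 1)) \<longlonglongrightarrow> 1 / 2" by real_asymp
  qed simp
  also have "(\<lambda>n. inverse (\<Prod>k=1..n. (4*real k^2) / (4*real k^2 - 1)) * (real n / (2 * real n + 1)))
     = (\<lambda>n. real n * central_ratio n ^ 2)"
    unfolding P by (rule ext) (simp add: divide_simps)
  finally show ?thesis by simp
qed

section \<open>The Wilf-Zeilberger pair\<close>

text \<open>
  This is \<open>\<Sum>m<n. 1 / (m + 1/2)^4\<close>, the sum of \<open>16 / i^4\<close> over the odd \<open>i < 2n\<close>; the form chosen here is
  the one that meets the harmonic numbers of the theorem.
\<close>
definition odd_H4 :: "nat \<Rightarrow> real" where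
  "odd_H4 n = 16 * H4 (2 * n) - H4 n"

lemma odd_H4_Suc: "odd_H4 (Suc n) = odd_H4 n + 1 / (real n + 1 / 2) ^ 4"
proof -
  have "16 / (2 * real n + 1) ^ 4 = 1 / (real n + 1 / 2) ^ 4"
  proof -
    have "(2 * real n + 1) ^ 4 = 16 * (real n + 1 / 2) ^ 4"
      using power_mult_distrib[of 2 "real n + 1 / 2" 4] by (simp add: algebra_simps)
    then show ?thesis by simp
  qed
  moreover have "16 / (2 * real n + 2) ^ 4 = 1 / (real n + 1) ^ 4"
  proof -
    have "(2 * real n + 2) ^ 4 = 16 * (real n + 1) ^ 4"
      using power_mult_distrib[of 2 "real n + 1" 4] by (simp add: algebra_simps)
    then show ?thesis by simp
  qed
  moreover have "H4 (2 * Suc n) = H4 (2 * n) + 1 / (2 * real n + 1) ^ 4 + 1 / (2 * real n + 2) ^ 4"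
    by (simp add: H4_Suc add_ac)
  ultimately show ?thesis by (simp add: odd_H4_def H4_Suc)
qed

lemma odd_H4_tendsto: "odd_H4 \<longlonglongrightarrow> 15 * zeta4"
proof -
  have "(\<lambda>n. H4 (2 * n)) \<longlonglongrightarrow> zeta4"
    using LIMSEQ_subseq_LIMSEQ[OF H4_tendsto, of "\<lambda>n. 2 * n"]
    by (simp add: o_def strict_mono_def)
  then have "(\<lambda>n. 16 * H4 (2 * n) - H4 n) \<longlonglongrightarrow> 16 * zeta4 - zeta4"
    by (intro tendsto_intros H4_tendsto)
  then show ?thesis by (simp add: odd_H4_def[abs_def])
qed

text \<open>
  The product \<open>W_0(n,j)\<close> of the introduction, written with binomial coefficients:
  \<open>(-1)^n (1/2)_n^5 (1/2)_j^4 / (4^n n! (n+j)!^4)\<close>.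
\<close>
definition weight :: "nat \<Rightarrow> nat \<Rightarrow> real" where
  "weight n j = (-1) ^ n * central_ratio n ^ 5 * central_ratio j ^ 4 / (4 ^ n * real ((n + j) choose n) ^ 4)"

text \<open>
  The logarithmic derivative of \<open>W_t(n,j)\<close> at \<open>t = 0\<close>: the three families of factors \<open>(m+1/2)^4 + 4t\<close>,
  \<open>(m+1/2)^4 - t\<close> and \<open>1 / (m^4 - t)\<close> give one term each.
\<close>
definition log_deriv :: "nat \<Rightarrow> nat \<Rightarrow> real" where
  "log_deriv n j = 4 * odd_H4 n - odd_H4 j + H4 (n + j)"

text \<open>
  The certificate. Comparing coefficients in the equation for the pair, under the assumption that the
  certificate is quadratic in \<open>j\<close> and free of \<open>t\<close>, determines it: \<open>j^5\<close> gives the leading coefficient,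
  the terms in \<open>t\<close> the linear one, and \<open>j = -n-1\<close> the constant one.
\<close>
definition cert :: "nat \<Rightarrow> nat \<Rightarrow> real" where
  "cert n j = real j ^ 2 / 2 + (3 * real n / 2 + 1 / 4) * real j + (20 * real n ^ 2 + 8 * real n + 1) / 16"

text \<open>The derivatives of \<open>F_t\<close> and \<open>G_t\<close> at \<open>t = 0\<close>.\<close>
definition wz_F :: "nat \<Rightarrow> nat \<Rightarrow> real" where
  "wz_F n j = real n * (2 * real j + real n + 1 / 2) * weight n j * log_deriv n j"

definition wz_G :: "nat \<Rightarrow> nat \<Rightarrow> real" where
  "wz_G n j = cert n j * weight n j * log_deriv n j"

lemma weight_Suc_left:
  "weight (Suc n) j = - weight n j * (real n + 1 / 2) ^ 5 / (4 * (real n + 1) * (real n + real j + 1) ^ 4)"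
proof -
  define B p u s where "B = real ((n + j) choose n)" and "p = real n + 1"
    and "u = real n + 1 / 2" and "s = real n + real j + 1"
  have pos: "B > 0" "p > 0" "s > 0" unfolding B_def p_def s_def by simp_all
  have "real (Suc n) * real ((Suc (n + j)) choose Suc n) = real (Suc (n + j)) * B"
    unfolding B_def of_nat_mult[symmetric] by (simp only: Suc_times_binomial)
  then have e: "real ((Suc n + j) choose Suc n) = B * s / p"
    by (simp add: p_def s_def field_simps)
  have c: "central_ratio (Suc n) = central_ratio n * u / p"
    by (simp add: central_ratio_Suc p_def u_def field_simps)
  have "weight (Suc n) j = - weight n j * u ^ 5 / (4 * p * s ^ 4)"
    unfolding weight_def e c B_def[symmetric] using pos
    by (simp add: field_simps) (simp add: eval_nat_numeral)
  then show ?thesis by (simp only: p_def u_def s_def)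
qed

lemma weight_Suc_right:
  "weight n (Suc j) = weight n j * (real j + 1 / 2) ^ 4 / (real n + real j + 1) ^ 4"
proof -
  define B p v s where "B = real ((n + j) choose n)" and "p = real j + 1"
    and "v = real j + 1 / 2" and "s = real n + real j + 1"
  have pos: "B > 0" "p > 0" "s > 0" unfolding B_def p_def s_def by simp_all
  have "Suc j * (Suc (n + j) choose n) = Suc (n + j) * ((n + j) choose n)"
    using binomial_absorb_comp[of "Suc (n + j)" n] by simp
  then have "real (Suc j) * real (Suc (n + j) choose n) = real (Suc (n + j)) * B"
    unfolding B_def by (metis of_nat_mult)
  then have e: "real ((n + Suc j) choose n) = B * s / p"
    by (simp add: p_def s_def field_simps)
  have c: "central_ratio (Suc j) = central_ratio j * v / p"
    by (simp add: central_ratio_Suc p_def v_def field_simps)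
  have "weight n (Suc j) = weight n j * v ^ 4 / s ^ 4"
    unfolding weight_def e c B_def[symmetric] using pos by (simp add: field_simps)
  then show ?thesis by (simp only: v_def s_def)
qed

text \<open>
  Modulo the ratios of neighbouring weights, the claim is linear in the logarithmic derivative. Its two
  parts are the conditions that the deformed pair satisfies to order 0 and 1 in \<open>t\<close>; they are \<open>t0\<close>
  and \<open>t1\<close> in the proof. In the centred variables \<open>u = n + 1/2\<close> and \<open>v = j + 1/2\<close> the first becomes
  the homogeneous identity
  \<open>(u+v)^4 (u^2 - 2uv + 2v^2) = v^4 (2v^2 + 6uv + 5u^2) + u^5 (u + 2v)\<close>.
\<close>
lemma wz_pair: "wz_F (Suc n) j - wz_F n j = wz_G n (Suc j) - wz_G n j"
proof -
  define x y u v s where "x = real n" and "y = real j" and "u = x + 1 / 2" and "v = y + 1 / 2" and "s = x + y + 1"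
  have pos: "x + 1 > 0" "u > 0" "v > 0" "s > 0"
    by (simp_all add: x_def y_def u_def v_def s_def)
  have L1: "log_deriv (Suc n) j = log_deriv n j + 4 / u ^ 4 + 1 / s ^ 4"
    by (simp add: log_deriv_def odd_H4_Suc H4_Suc x_def y_def u_def s_def add_ac)
  have L2: "log_deriv n (Suc j) = log_deriv n j - 1 / v ^ 4 + 1 / s ^ 4"
    by (simp add: log_deriv_def odd_H4_Suc H4_Suc x_def y_def v_def s_def add_ac)
  have W1: "weight (Suc n) j = - weight n j * u ^ 5 / (4 * (x + 1) * s ^ 4)"
    by (simp add: weight_Suc_left x_def y_def u_def s_def)
  have W2: "weight n (Suc j) = weight n j * v ^ 4 / s ^ 4"
    by (simp add: weight_Suc_right x_def y_def v_def s_def)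
  define a where "a = 2 * y + x + 3 / 2"
  define b where "b = x * (2 * y + x + 1 / 2)"
  define h where "h = (2 * v ^ 2 + 6 * u * v + 5 * u ^ 2) / 4"
  have g1: "cert n (Suc j) = h"
    by (simp add: cert_def h_def u_def v_def x_def y_def power2_eq_square field_simps)
  have g0: "cert n j = h - v - 3 * u / 2 + 1 / 2"
    by (simp add: cert_def h_def u_def v_def x_def y_def power2_eq_square field_simps)
  have a: "a = 2 * v + u"
    by (simp add: a_def u_def v_def)
  have b: "b = 2 * u * v + u ^ 2 - 3 * u / 2 - v + 1 / 2"
    by (simp add: b_def u_def v_def power2_eq_square field_simps)
  have s_uv: "s = u + v"
    by (simp add: s_def u_def v_def)
  have t0: "- (u ^ 5 / 4) * a - b * s ^ 4 = cert n (Suc j) * v ^ 4 - cert n j * s ^ 4"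
  proof -
    have "s ^ 4 * (u ^ 2 - 2 * u * v + 2 * v ^ 2) = v ^ 4 * (2 * v ^ 2 + 6 * u * v + 5 * u ^ 2) + u ^ 5 * (2 * v + u)"
      unfolding s_uv by algebra
    moreover have "4 * (cert n j - b) = u ^ 2 - 2 * u * v + 2 * v ^ 2"
      unfolding g0 b h_def by (simp add: field_simps)
    ultimately have "s ^ 4 * (4 * (cert n j - b)) = v ^ 4 * (4 * h) + u ^ 5 * a"
      unfolding a h_def by simp
    then show ?thesis
      unfolding g1 by (simp add: algebra_simps)
  qed
  have t1: "- u * a + b = - cert n (Suc j) + cert n j"
    unfolding g0 g1 a b by (simp add: algebra_simps power2_eq_square)
  have F1: "wz_F (Suc n) j * s ^ 4 = weight n j * (- (u ^ 5 / 4) * a * (log_deriv n j + 1 / s ^ 4) - u * a)"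
  proof -
    have "wz_F (Suc n) j = (x + 1) * a * weight (Suc n) j * log_deriv (Suc n) j"
      by (simp add: wz_F_def a_def x_def y_def algebra_simps)
    moreover have "(x + 1) * a * weight (Suc n) j * s ^ 4 = - (u ^ 5 / 4) * a * weight n j"
      unfolding W1 using pos by (simp del: distrib_left_numeral)
    ultimately have "wz_F (Suc n) j * s ^ 4 = - (u ^ 5 / 4) * a * weight n j * log_deriv (Suc n) j"
      by algebra
    moreover have "u ^ 5 / 4 * (4 / u ^ 4) = u"
      using pos by (simp add: eval_nat_numeral)
    ultimately show ?thesis
      unfolding L1 by algebra
  qed
  have F0: "wz_F n j = b * weight n j * log_deriv n j"
    by (simp add: wz_F_def b_def x_def y_def)
  have G1: "wz_G n (Suc j) * s ^ 4 = weight n j * (cert n (Suc j) * v ^ 4 * (log_deriv n j + 1 / s ^ 4) - cert n (Suc j))"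
    unfolding wz_G_def W2 L2 using pos
    by (simp add: divide_simps) (simp add: algebra_simps)
  have "(wz_F (Suc n) j - wz_F n j) * s ^ 4 
      = weight n j * ((- (u ^ 5 / 4) * a - b * s ^ 4) * (log_deriv n j + 1 / s ^ 4) + (- u * a + b))"
    unfolding left_diff_distrib F1 F0 using pos by (simp add: field_simps)
  also have "\<dots> = (wz_G n (Suc j) - wz_G n j) * s ^ 4"
    unfolding left_diff_distrib G1 t0 t1 unfolding wz_G_def using pos by (simp add: field_simps)
  finally show ?thesis using pos by simp
qed

section \<open>Summation along the diagonal\<close>

definition summand :: "nat \<Rightarrow> real" where
  "summand k = real ((2 * k) choose k) ^ 5 / (- (2 ^ 20)) ^ k *
            ((820 * real k ^ 2 + 180 * real k + 13) *
               (49 * harmonic_number 4 (2 * k) - 3 * harmonic_number 4 k)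
             - 195 / (2 * real k + 1) ^ 2)"

text \<open>
  Here \<open>(2n choose n)^4\<close> in the denominator cancels four of the nine factors \<open>central_ratio n\<close> and leaves
  \<open>4^(-4n)\<close>.
\<close>
lemma weight_diag: "weight n n = real ((2 * n) choose n) ^ 5 / (- (2 ^ 20)) ^ n"
proof -
  have "(- (2 ^ 20) :: real) ^ n = (-1) ^ n * (4 ^ n) ^ 10"
  proof -
    have "(- (2 ^ 20) :: real) = (-1) * 4 ^ 10" by simp
    then show ?thesis by (simp only: power_mult_distrib power_mult[symmetric] mult.commute[of 10])
  qed
  moreover have "(-1) ^ n * (-1 :: real) ^ n = 1" by (simp flip: power_mult_distrib)
  ultimately show ?thesis
    by (simp add: weight_def central_ratio_def mult_2[symmetric] divide_simps power_mult_distrib)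
       (simp add: eval_nat_numeral)
qed

text \<open>
  One stair of the path from \<open>(0,0)\<close> to \<open>(M,M)\<close>. The denominator \<open>n + j + 1\<close> becomes \<open>2n + 1 = 2u\<close> on the
  diagonal, so the factor of \<open>wz_F (Suc n) n\<close> in front of the logarithmic derivative is
  \<open>- 3 u^2 / 64\<close> times the weight; together with the certificate it gives \<open>(820 n^2 + 180 n + 13) / 256\<close>.
  The increment \<open>4/u^4 + 1/(2u)^4\<close> of the logarithmic derivative produces the term \<open>195 / (2n+1)^2\<close>.
\<close>
lemma diagonal_step: "wz_G n n + wz_F (Suc n) n = summand n / 256"
proof -
  define x u where "x = real n" and "u = x + 1 / 2"
  have pos: "u > 0" "x + 1 > 0" by (simp_all add: x_def u_def)
  have s: "real n + real n + 1 = 2 * u" by (simp add: u_def x_def)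
  have Ln: "log_deriv n n = 49 * H4 (2 * n) - 3 * H4 n"
    by (simp add: log_deriv_def odd_H4_def mult_2[symmetric])
  have L1: "log_deriv (Suc n) n = log_deriv n n + 4 / u ^ 4 + 1 / (2 * u) ^ 4"
  proof -
    have "H4 (Suc n + n) = H4 (n + n) + 1 / (2 * u) ^ 4"
      by (simp add: H4_Suc u_def x_def)
    moreover have "odd_H4 (Suc n) = odd_H4 n + 1 / u ^ 4"
      by (simp add: odd_H4_Suc u_def x_def)
    ultimately show ?thesis by (simp only: log_deriv_def) (simp add: algebra_simps)
  qed
  have W1: "weight (Suc n) n = - weight n n * u ^ 5 / (4 * (x + 1) * (2 * u) ^ 4)"
    unfolding weight_Suc_left s by (simp add: u_def x_def)
  have "wz_F (Suc n) n = (x + 1) * (3 * u) * weight (Suc n) n * log_deriv (Suc n) n"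
    by (simp add: wz_F_def u_def x_def algebra_simps)
  also have "\<dots> = - weight n n * (3 * u ^ 2 / 64 * log_deriv n n + 195 / (1024 * u ^ 2))"
    (is "_ = ?rhs")
  proof -
    have "(x + 1) * (3 * u) * weight (Suc n) n = - weight n n * (3 * u ^ 2 / 64)"
      unfolding W1 using pos by (simp add: power_mult_distrib divide_simps) (simp add: eval_nat_numeral)
    then have "(x + 1) * (3 * u) * weight (Suc n) n * log_deriv (Suc n) n = - weight n n * (3 * u ^ 2 / 64 * log_deriv (Suc n) n)"
      by simp
    also have "3 * u ^ 2 / 64 * log_deriv (Suc n) n = 3 * u ^ 2 / 64 * log_deriv n n + 195 / (1024 * u ^ 2)"
      unfolding L1 using pos by (simp add: power_mult_distrib divide_simps)
    finally show ?thesis .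
  qed
  finally have F1: "wz_F (Suc n) n = \<dots>" .
  have gd: "cert n n - 3 * u ^ 2 / 64 = (820 * x ^ 2 + 180 * x + 13) / 256"
    by (simp add: cert_def u_def x_def[symmetric] field_simps power2_eq_square)
  have "195 / (1024 * u ^ 2) = 195 / (2 * x + 1) ^ 2 / 256"
    using pos by (simp add: u_def divide_simps)
  then have "wz_G n n + wz_F (Suc n) n = weight n n * ((cert n n - 3 * u ^ 2 / 64) * log_deriv n n - 195 / (2 * x + 1) ^ 2 / 256)"
    unfolding wz_G_def F1 by (simp add: algebra_simps)
  also have "\<dots> = weight n n * ((820 * x ^ 2 + 180 * x + 13) * log_deriv n n - 195 / (2 * x + 1) ^ 2) / 256"
    unfolding gd by (simp add: diff_divide_distrib)
  also have "\<dots> = summand n / 256"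
    by (simp only: summand_def weight_diag Ln x_def)
  finally show ?thesis .
qed

text \<open>
  Path independence, by induction on the size of the square: passing from the column \<open>j = M\<close> to
  \<open>j = M + 1\<close> costs a telescoping sum of \<open>wz_F\<close>, whose lower end \<open>wz_F 0 M\<close> is zero.
\<close>
lemma partial_sum_eq: "(\<Sum>k<M. summand k) = 256 * (\<Sum>n<M. wz_G n M)"
proof -
  have "(\<Sum>n<M. wz_G n M) = (\<Sum>k<M. wz_G k k + wz_F (Suc k) k)"
  proof (induction M)
    case (Suc M)
    have "(\<Sum>n<Suc M. wz_G n (Suc M) - wz_G n M) = (\<Sum>n<Suc M. wz_F (Suc n) M - wz_F n M)"
      by (simp only: wz_pair)
    also have "\<dots> = wz_F (Suc M) M"
      by (subst sum_lessThan_telescope) (simp add: wz_F_def)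
    finally show ?case using Suc by (simp add: sum_subtractf)
  qed simp
  then show ?thesis by (simp add: diagonal_step sum_divide_distrib[symmetric])
qed

section \<open>Passage to the limit\<close>

lemma wz_G_0_tendsto: "(\<lambda>M. wz_G 0 M) \<longlonglongrightarrow> - 14 * zeta4 / (2 * pi ^ 2)"
proof -
  have "(\<lambda>M. (real M * central_ratio M ^ 2) ^ 2 * (cert 0 M / real M ^ 2) * (H4 M - odd_H4 M))
     \<longlonglongrightarrow> (1 / pi) ^ 2 * (1 / 2) * (zeta4 - 15 * zeta4)"
  proof (intro tendsto_mult tendsto_power tendsto_diff central_ratio_asymp H4_tendsto odd_H4_tendsto)
    show "(\<lambda>M. cert 0 M / real M ^ 2) \<longlonglongrightarrow> 1 / 2"
      unfolding cert_def by real_asymp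
  qed
  moreover have "\<forall>\<^sub>F M in sequentially. (real M * central_ratio M ^ 2) ^ 2 * (cert 0 M / real M ^ 2) * (H4 M - odd_H4 M) = wz_G 0 M"
    using eventually_gt_at_top[of 0]
  proof eventually_elim
    case (elim M)
    then show ?case
      by (simp add: wz_G_def weight_def log_deriv_def odd_H4_def[of 0] H4_0 central_ratio_def[of 0] power_mult_distrib field_simps flip: power_mult)
  qed
  ultimately have "(\<lambda>M. wz_G 0 M) \<longlonglongrightarrow> (1 / pi) ^ 2 * (1 / 2) * (zeta4 - 15 * zeta4)"
    by (rule Lim_transform_eventually)
  then show ?thesis by (simp add: power_divide field_simps)
qed

text \<open>
  For \<open>n > 0\<close> the binomial coefficient is at least \<open>j + 1\<close>; its fourth power beats the quadratic growth of
  the certificate.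
\<close>
lemma abs_weight_le:
  assumes "n > 0"
  shows "\<bar>weight n j\<bar> \<le> (1 / 4) ^ n / (real j + 1) ^ 4"
proof -
  have "Suc j \<le> (n + j) choose n"
  proof -
    have "Suc j = (1 + j) choose j" by simp
    also have "\<dots> \<le> (n + j) choose j" using assms by (intro binomial_right_mono) auto
    also have "\<dots> = (n + j) choose n" by (simp add: binomial_symmetric[of j "n + j"])
    finally show ?thesis .
  qed
  then have b: "real j + 1 \<le> real ((n + j) choose n)" by linarith
  have "\<bar>weight n j\<bar> = (central_ratio n ^ 5 * central_ratio j ^ 4) * (1 / 4) ^ n / real ((n + j) choose n) ^ 4"
    using central_ratio_pos[of n] central_ratio_pos[of j]
    by (simp add: weight_def abs_mult power_abs power_divide)
  also have "\<dots> \<le> 1 * (1 / 4) ^ n / (real j + 1) ^ 4"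
    using b central_ratio_pos[of n] central_ratio_pos[of j] central_ratio_le_1
    by (intro frac_le mult_right_mono mult_le_one power_le_one power_mono) (auto simp: less_imp_le)
  finally show ?thesis by simp
qed

lemma odd_H4_bounds: "- zeta4 \<le> odd_H4 n" "odd_H4 n \<le> 16 * zeta4"
  using H4_bounds[of n] H4_bounds[of "2 * n"] unfolding odd_H4_def by linarith+

lemma abs_log_deriv_le: "\<bar>log_deriv n j\<bar> \<le> 80 * zeta4"
  using odd_H4_bounds[of n] odd_H4_bounds[of j] H4_bounds[of "n + j"]
  unfolding log_deriv_def by linarith

lemma abs_wz_G_le:
  assumes "0 < n" "n \<le> M"
  shows "\<bar>wz_G n M\<bar> \<le> 400 * zeta4 / (real M + 1) ^ 2 * (1 / 4) ^ n"
proof -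
  have cert: "0 \<le> cert n M" "cert n M \<le> 5 * (real M + 1) ^ 2"
  proof -
    have g_expand: "cert n M = real M * real M / 2 + 3 / 2 * (real n * real M) + real M / 4
        + 5 / 4 * (real n * real n) + real n / 2 + 1 / 16"
      by (simp add: cert_def power2_eq_square field_simps)
    have nM: "real n \<le> real M" using assms by simp
    have "real n * real M \<le> real M * real M" "real n * real n \<le> real M * real M" "0 \<le> real M * real M"
      using nM by (auto intro!: mult_mono)
    then have "cert n M \<le> 4 * (real M * real M) + real M + 1"
      using nM unfolding g_expand by linarith
    also have "\<dots> \<le> 5 * (real M + 1) ^ 2"
      by (simp add: power2_eq_square algebra_simps)
    finally show "cert n M \<le> 5 * (real M + 1) ^ 2" .
    show "0 \<le> cert n M" unfolding cert_def by simp
  qed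
  have z: "0 \<le> zeta4" using H4_bounds[of 0] by linarith
  have "\<bar>wz_G n M\<bar> = cert n M * \<bar>weight n M\<bar> * \<bar>log_deriv n M\<bar>"
    using cert by (simp add: wz_G_def abs_mult)
  also have "\<dots> \<le> (5 * (real M + 1) ^ 2) * ((1 / 4) ^ n / (real M + 1) ^ 4) * (80 * zeta4)"
    using cert z abs_weight_le[OF assms(1)] abs_log_deriv_le by (intro mult_mono) auto
  also have "\<dots> = 400 * zeta4 / (real M + 1) ^ 2 * (1 / 4) ^ n"
    by (simp add: divide_simps)
  finally show ?thesis .
qed

lemma wz_G_tail_tendsto_0: "(\<lambda>M. \<Sum>n=1..<M. wz_G n M) \<longlonglongrightarrow> 0"
proof (rule Lim_null_comparison)
  have z: "0 \<le> zeta4" using H4_bounds[of 0] by linarith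
  show "(\<lambda>M. 400 * zeta4 / (real M + 1) ^ 2 * 2) \<longlonglongrightarrow> 0"
    by real_asymp
  have "\<bar>\<Sum>n=1..<M. wz_G n M\<bar> \<le> 400 * zeta4 / (real M + 1) ^ 2 * 2" for M
  proof -
    have "\<bar>\<Sum>n=1..<M. wz_G n M\<bar> \<le> (\<Sum>n=1..<M. \<bar>wz_G n M\<bar>)" by (rule sum_abs)
    also have "\<dots> \<le> (\<Sum>n=1..<M. 400 * zeta4 / (real M + 1) ^ 2 * (1 / 4) ^ n)"
      by (intro sum_mono abs_wz_G_le) auto
    also have "\<dots> = 400 * zeta4 / (real M + 1) ^ 2 * (\<Sum>n=1..<M. (1 / 4) ^ n)"
      by (simp add: sum_distrib_left)
    also have "\<dots> \<le> 400 * zeta4 / (real M + 1) ^ 2 * 2"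
    proof (intro mult_left_mono)
      have "(\<Sum>n=1..<M. (1 / 4 :: real) ^ n) \<le> (\<Sum>n. (1 / 4) ^ n)"
        by (intro sum_le_suminf summable_geometric) auto
      then show "(\<Sum>n=1..<M. (1 / 4 :: real) ^ n) \<le> 2"
        by (simp add: suminf_geometric)
    qed (use z in simp)
    finally show ?thesis .
  qed
  then show "\<forall>\<^sub>F M in sequentially. norm (\<Sum>n=1..<M. wz_G n M) \<le> 400 * zeta4 / (real M + 1) ^ 2 * 2"
    by simp
qed

theorem theorem1p3:
  shows "(\<lambda>k::nat. real ((2 * k) choose k) ^ 5 / (- (2 ^ 20)) ^ k *
            ((820 * real k ^ 2 + 180 * real k + 13) *
               (49 * harmonic_number 4 (2 * k) - 3 * harmonic_number 4 k)
             - 195 / (2 * real k + 1) ^ 2))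
         sums (- (896 / 45) * pi ^ 2)"
proof -
  have "(\<lambda>M. wz_G 0 M + (\<Sum>n=1..<M. wz_G n M)) \<longlonglongrightarrow> - 14 * zeta4 / (2 * pi ^ 2) + 0"
    by (intro tendsto_add wz_G_0_tendsto wz_G_tail_tendsto_0)
  moreover have "\<forall>\<^sub>F M in sequentially. wz_G 0 M + (\<Sum>n=1..<M. wz_G n M) = (\<Sum>n<M. wz_G n M)"
    using eventually_gt_at_top[of 0]
    by eventually_elim (simp add: lessThan_atLeast0 sum.atLeast_Suc_lessThan)
  ultimately have "(\<lambda>M. \<Sum>n<M. wz_G n M) \<longlonglongrightarrow> - 14 * zeta4 / (2 * pi ^ 2) + 0"
    by (rule Lim_transform_eventually)
  then have "(\<lambda>M. 256 * (\<Sum>n<M. wz_G n M)) \<longlonglongrightarrow> 256 * (- 14 * zeta4 / (2 * pi ^ 2) + 0)"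
    by (intro tendsto_intros)
  moreover have "256 * (- 14 * zeta4 / (2 * pi ^ 2) + 0) = - (896 / 45) * pi ^ 2"
    by (simp add: zeta4_eq field_simps eval_nat_numeral)
  ultimately have "summand sums (- (896 / 45) * pi ^ 2)"
    by (simp only: sums_def partial_sum_eq)
  then show ?thesis
    by (simp only: summand_def[abs_def])
qed

end
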